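(* The regret of $\mathsf{SemiUCB}$ is $\Omega(K\min(d,T))$.
   Context: Notation: $[k]=\{1,\dots,k\}$; $\|\cdot\|$ is the Euclidean norm; $I_{d\times d}$ is the $d\times d$ identity matrix. Semi-bandit problem with linear generalization. There are $N$ distinct products (arms) and $T$ periods; product $i\in[N]$ has a feature vector $x_i\in\mathbb{R}^d$ with $\|x_i\|\le 1$, known in advance and fixed over time (different products may have equal feature vectors). There is an unknown $\theta^*\in\mathbb{R}^d$ with $\|\theta^*\|\le 1$, and $\mu(i):=x_i^\top\theta^*\in[0,1]$ for all $i\in[N]$. In each period $t\in[T]$ the player chooses a set $S_t\subset[N]$ with $|S_t|=K$ based on all past information, and then observes $r_{t,i}\in\{0,1\}$ for each $i\in S_t$. The variables $r_{t,i}$ are independent across products and across periods, with $\mathbb{E}[r_{t,i}]=\mu(i)$. Let $S^*\in\arg\max_{S\subset[N],|S|=K}\sum_{i\in S}\mu(i)$. The regret is $R(T)=\sum_{t=1}^T\sum_{i\in S^*}\mu(i)-\sum_{t=1}^T\sum_{i\in S_t}\mu(i)$. Algorithm $\mathsf{SemiUCB}$ (input parameters $\alpha,\omega$). Initialize $A_0=\omega I_{d\times d}$, $b_0=0\in\mathbb{R}^d$. For $t=1,\dots,T$: (a) set $\theta_t=A_{t-1}^{-1}b_{t-1}$; (b) compute $p_t(i)=x_i^\top\theta_t+\alpha\sqrt{x_i^\top A_{t-1}^{-1}x_i}$ for all $i\in[N]$; (c) offer $S_t\in\arg\max_{S\subset[N],|S|=K}\sum_{i\in S}p_t(i)$ and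 observe $r_{t,i}$ for $i\in S_t$; (d) set $A_t=A_{t-1}+\sum_{i\in S_t}x_ix_i^\top$ and $b_t=b_{t-1}+\sum_{i\in S_t}r_{t,i}x_i$. The statement is a lower bound on the regret $R(T)$ of this algorithm, in the sense that there are problem instances on which the regret is of at least this order.
   Formalization: The bound is stated with a uniform constant for d ≥ 2 and parameters α, ω > 0; for d = 1 and α > 0 the scores order products exactly as their means do, so the regret is 0 on every instance and the bound fails. *)

theory Defs
  imports "HOL-Probability.Product_PMF" "Jordan_Normal_Form.Gauss_Jordan_Elimination"
begin

(* HOL-Analysis and Jordan_Normal_Form both use the symbols for vector components and for the
   scalar product; only the latter reading is used here. *)
unbundle no vec_syntax
unbundle no inner_syntax

definition eucl_norm :: "real Matrix.vec \<Rightarrow> real" where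
  "eucl_norm v = sqrt (v \<bullet> v)"

definition mean_reward :: "(nat \<Rightarrow> real Matrix.vec) \<Rightarrow> real Matrix.vec \<Rightarrow> nat \<Rightarrow> real" where
  "mean_reward x \<theta> i = x i \<bullet> \<theta>"

definition semi_bandit_instance ::
  "nat \<Rightarrow> nat \<Rightarrow> nat \<Rightarrow> (nat \<Rightarrow> real Matrix.vec) \<Rightarrow> real Matrix.vec \<Rightarrow> bool" where
  "semi_bandit_instance d N K x \<theta> \<longleftrightarrow>
     K \<le> N \<and>
     (\<forall>i\<in>{1..N}. x i \<in> carrier_vec d \<and> eucl_norm (x i) \<le> 1) \<and>
     \<theta> \<in> carrier_vec d \<and> eucl_norm \<theta> \<le> 1 \<and>
     (\<forall>i\<in>{1..N}. mean_reward x \<theta> i \<in> {0..1})"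

definition feasible_offer :: "nat \<Rightarrow> nat \<Rightarrow> nat set \<Rightarrow> bool" where
  "feasible_offer N K S \<longleftrightarrow> S \<subseteq> {1..N} \<and> card S = K"

(* The joint law of the whole table of rewards: entry (t, i) is the 0/1 reward (False/True) that
   product i yields in period t if it is offered.  The entries are independent, and a variable
   with values in {0, 1} and mean p has the Bernoulli law with parameter p. *)
definition reward_table ::
  "nat \<Rightarrow> nat \<Rightarrow> (nat \<Rightarrow> real Matrix.vec) \<Rightarrow> real Matrix.vec \<Rightarrow> (nat \<times> nat \<Rightarrow> bool) pmf" where
  "reward_table N T x \<theta> =
     Pi_pmf ({1..T} \<times> {1..N}) False (\<lambda>(t, i). bernoulli_pmf (mean_reward x \<theta> i))"

definition optimal_offer ::
  "nat \<Rightarrow> nat \<Rightarrow> (nat \<Rightarrow> real Matrix.vec) \<Rightarrow> real Matrix.vec \<Rightarrow> nat set" where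
  "optimal_offer N K x \<theta> = arg_max (\<lambda>S. \<Sum>i\<in>S. mean_reward x \<theta> i) (feasible_offer N K)"

definition regret ::
  "nat \<Rightarrow> nat \<Rightarrow> nat \<Rightarrow> (nat \<Rightarrow> real Matrix.vec) \<Rightarrow> real Matrix.vec \<Rightarrow> (nat \<Rightarrow> nat set) \<Rightarrow> real" where
  "regret N K T x \<theta> S =
     (\<Sum>t=1..T. \<Sum>i\<in>optimal_offer N K x \<theta>. mean_reward x \<theta> i) -
     (\<Sum>t=1..T. \<Sum>i\<in>S t. mean_reward x \<theta> i)"

(* The matrices A_t of the algorithm.  The sum of the matrices x_i x_i^T over the offered products
   is written entrywise because the type of matrices is not an additive monoid. *)
primrec design_mat ::
  "nat \<Rightarrow> real \<Rightarrow> (nat \<Rightarrow> real Matrix.vec) \<Rightarrow> (nat \<Rightarrow> nat set) \<Rightarrow> nat \<Rightarrow> real Matrix.mat" where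
  "design_mat d \<omega> x S 0 = \<omega> \<cdot>\<^sub>m 1\<^sub>m d"
| "design_mat d \<omega> x S (Suc t) =
     design_mat d \<omega> x S t + Matrix.mat d d (\<lambda>(j, k). \<Sum>i\<in>S (Suc t). x i $ j * x i $ k)"

(* The vectors b_t, computed from the reward table r along the offers S. *)
primrec response_vec ::
  "nat \<Rightarrow> (nat \<Rightarrow> real Matrix.vec) \<Rightarrow> (nat \<times> nat \<Rightarrow> bool) \<Rightarrow> (nat \<Rightarrow> nat set) \<Rightarrow> nat \<Rightarrow> real Matrix.vec"
where
  "response_vec d x r S 0 = 0\<^sub>v d"
| "response_vec d x r S (Suc t) =
     response_vec d x r S t +
     Matrix.vec d (\<lambda>j. \<Sum>i\<in>S (Suc t). of_bool (r (Suc t, i)) * x i $ j)"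

(* The score p_t(i) for t \<ge> 1.  The option-valued mat_inverse returns a value exactly on invertible
   matrices; for \<omega> > 0 every matrix occurring here is positive definite. *)
definition ucb_score ::
  "nat \<Rightarrow> (nat \<Rightarrow> real Matrix.vec) \<Rightarrow> real \<Rightarrow> real \<Rightarrow> (nat \<times> nat \<Rightarrow> bool) \<Rightarrow> (nat \<Rightarrow> nat set) \<Rightarrow>
     nat \<Rightarrow> nat \<Rightarrow> real" where
  "ucb_score d x \<alpha> \<omega> r S t i =
     (let Ainv = the (mat_inverse (design_mat d \<omega> x S (t - 1)));
          \<theta>t = Ainv *\<^sub>v response_vec d x r S (t - 1)
      in x i \<bullet> \<theta>t + \<alpha> * sqrt (x i \<bullet> (Ainv *\<^sub>v x i)))"

(* S r t is the set offered in period t when the reward table is r; it may depend only on the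
   rewards observed in earlier periods. *)
definition non_anticipating :: "nat \<Rightarrow> ((nat \<times> nat \<Rightarrow> bool) \<Rightarrow> nat \<Rightarrow> nat set) \<Rightarrow> bool" where
  "non_anticipating T S \<longleftrightarrow>
     (\<forall>r r'. \<forall>t\<in>{1..T}.
        (\<forall>s\<in>{1..<t}. \<forall>i\<in>S r s. r (s, i) = r' (s, i)) \<longrightarrow> S r t = S r' t)"

(* S is an execution of SemiUCB.  Ties among maximisers may be broken by any rule based on past
   information, so several S satisfy this predicate in general. *)
definition semi_ucb ::
  "nat \<Rightarrow> nat \<Rightarrow> nat \<Rightarrow> nat \<Rightarrow> (nat \<Rightarrow> real Matrix.vec) \<Rightarrow> real \<Rightarrow> real \<Rightarrow>
     ((nat \<times> nat \<Rightarrow> bool) \<Rightarrow> nat \<Rightarrow> nat set) \<Rightarrow> bool" where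
  "semi_ucb d N K T x \<alpha> \<omega> S \<longleftrightarrow>
     non_anticipating T S \<and>
     (\<forall>r. \<forall>t\<in>{1..T}.
        is_arg_max (\<lambda>U. \<Sum>i\<in>U. ucb_score d x \<alpha> \<omega> r (S r) t i) (feasible_offer N K) (S r t))"

end

theory Submission
  imports Defs
begin

text \<open>
  The lower bound comes from making the algorithm explore. Put $K$ copies of a product on each of
  the $d$ coordinate axes and let the hidden parameter be the last unit vector. Then only the $K$
  products on the last axis have positive mean, and all others pay exactly $0$.

  A product on an unexplored axis has score $\alpha \|x\| / \sqrt{\omega}$ as long as all observed
  rewards are $0$: the design matrix is diagonal with entry $\omega$ on that axis, and the estimate
  of the parameter is still $0$. Hence among the unexplored axes the algorithm prefers
  the one with the longest vectors. Taking the lengths strictly decreasing along the axes forces it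
  to open the axes in order and at most one per period: each axis holds $K$ products, so an offer
  that reaches past the next unexplored axis leaves some product of that axis out, and putting
  it in instead would raise the total score. In period $t$ only the first $t$ axes can be offered (\<open>staircase_exploration\<close>), whatever $\alpha$,
  $\omega$ and the tie-breaking rule are. So in each of the first $\min(d-1, T)$ periods the whole
  optimal reward is lost. The lengths can be kept in $[1/2, 1]$, which makes this loss at
  least $K/2$ per period.

  The bound holds for every reward table in the support of the law, hence almost surely and in
  expectation.
\<close>


section \<open>Scores in unexplored directions\<close>

lemma the_mat_inverse_mat_diag:
  fixes f :: "nat \<Rightarrow> 'a :: field"
  assumes "\<And>j. j < n \<Longrightarrow> f j \<noteq> 0"
  shows "the (mat_inverse (mat_diag n f)) = mat_diag n (\<lambda>j. 1 / f j)"
proof -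
  let ?A = "mat_diag n f" and ?B = "mat_diag n (\<lambda>j. 1 / f j)"
  have "mat_diag n (\<lambda>j. f j * (1 / f j)) = mat_diag n (\<lambda>j. 1)"
    "mat_diag n (\<lambda>j. 1 / f j * f j) = mat_diag n (\<lambda>j. 1)"
    using assms by (auto simp: mat_diag_def)
  then have AB: "?A * ?B = 1\<^sub>m n" and BA: "?B * ?A = 1\<^sub>m n"
    by auto
  have "?A \<in> Units (ring_mat TYPE('a) n undefined)"
    unfolding Units_def ring_mat_simps mem_Collect_eq using AB BA mat_diag_dim by blast
  then obtain C where C: "mat_inverse ?A = Some C"
    using mat_inverse(1)[OF mat_diag_dim] by fastforce
  then have "?A * C = 1\<^sub>m n" and dim: "C \<in> carrier_mat n n"
    using mat_inverse(2)[OF mat_diag_dim] by auto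
  then have "?B * ?A * C = ?B"
    using assoc_mult_mat[OF mat_diag_dim mat_diag_dim dim, of "\<lambda>j. 1 / f j" f]
      right_mult_one_mat[OF mat_diag_dim] by simp
  then show ?thesis
    using C BA dim by simp
qed

text \<open>The orthogonality condition says that every offered vector is parallel to a coordinate axis,
  so that the off-diagonal entries of all its outer products vanish.\<close>

lemma design_mat_axis_parallel:
  assumes "\<And>s i j l. s \<in> {1..t} \<Longrightarrow> i \<in> S s \<Longrightarrow> j < d \<Longrightarrow> l < d \<Longrightarrow> j \<noteq> l \<Longrightarrow> x i $ j * x i $ l = 0"
  shows "design_mat d \<omega> x S t = mat_diag d (\<lambda>j. \<omega> + (\<Sum>s=1..t. \<Sum>i\<in>S s. (x i $ j)\<^sup>2))"
  using assms
proof (induction t)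
  case 0
  show ?case by (rule eq_matI) (auto simp: mat_diag_def)
next
  case (Suc t)
  have IH: "design_mat d \<omega> x S t = mat_diag d (\<lambda>j. \<omega> + (\<Sum>s=1..t. \<Sum>i\<in>S s. (x i $ j)\<^sup>2))"
    by (rule Suc.IH, rule Suc.prems) auto
  have "(\<Sum>i\<in>S (Suc t). x i $ j * x i $ l) = 0" if "j < d" "l < d" "j \<noteq> l" for j l
    by (intro sum.neutral ballI Suc.prems[of "Suc t"]) (use that in auto)
  then show ?case
    unfolding design_mat.simps IH
    by (intro eq_matI) (auto simp: mat_diag_def power2_eq_square)
qed

lemma response_vec_zero:
  assumes "\<And>s i. s \<in> {1..t} \<Longrightarrow> i \<in> S s \<Longrightarrow> \<not> r (s, i)"
  shows "response_vec d x r S t = 0\<^sub>v d"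
  using assms
proof (induction t)
  case (Suc t)
  have "response_vec d x r S t = 0\<^sub>v d"
    by (rule Suc.IH) (use Suc.prems in auto)
  then show ?case
    using Suc.prems by (auto intro!: eq_vecI sum.neutral)
qed simp

text \<open>Without any positive reward the estimate is $0$, and without any offer along axis $j$ the
  design matrix still has its initial entry $\omega$ there. Only the confidence term of the
  initial state remains.\<close>

lemma ucb_score_unexplored:
  assumes \<omega>: "\<omega> > 0" and j: "j < d"
    and axis: "\<And>s i j l. s \<in> {1..t} \<Longrightarrow> i \<in> S s \<Longrightarrow> j < d \<Longrightarrow> l < d \<Longrightarrow> j \<noteq> l \<Longrightarrow> x i $ j * x i $ l = 0"
    and unexplored: "\<And>s i. s \<in> {1..t} \<Longrightarrow> i \<in> S s \<Longrightarrow> x i $ j = 0"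
    and no_reward: "\<And>s i. s \<in> {1..t} \<Longrightarrow> i \<in> S s \<Longrightarrow> \<not> r (s, i)"
    and m: "x m = a \<cdot>\<^sub>v unit_vec d j"
  shows "ucb_score d x \<alpha> \<omega> r S (Suc t) m = \<alpha> * (\<bar>a\<bar> / sqrt \<omega>)"
proof -
  define D where "D l = \<omega> + (\<Sum>s=1..t. \<Sum>i\<in>S s. (x i $ l)\<^sup>2)" for l
  have design: "design_mat d \<omega> x S t = mat_diag d D"
    unfolding D_def by (rule design_mat_axis_parallel[OF axis])
  have "D l > 0" for l
    unfolding D_def using \<omega> by (intro add_pos_nonneg sum_nonneg) auto
  then have inv: "the (mat_inverse (design_mat d \<omega> x S t)) = mat_diag d (\<lambda>l. 1 / D l)"
    unfolding design by (intro the_mat_inverse_mat_diag) (simp add: less_imp_neq[symmetric])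
  have Dj: "D j = \<omega>"
    unfolding D_def using unexplored by simp
  have "mat_diag d (\<lambda>l. 1 / D l) *\<^sub>v unit_vec d j = (1 / \<omega>) \<cdot>\<^sub>v unit_vec d j"
    using j Dj by (intro eq_vecI) (auto simp: mat_diag_def)
  moreover have "mat_diag d (\<lambda>l. 1 / D l) *\<^sub>v (a \<cdot>\<^sub>v unit_vec d j) =
      a \<cdot>\<^sub>v (mat_diag d (\<lambda>l. 1 / D l) *\<^sub>v unit_vec d j)"
    by (rule mult_mat_vec[OF mat_diag_dim unit_vec_carrier])
  ultimately have "mat_diag d (\<lambda>l. 1 / D l) *\<^sub>v x m = (a / \<omega>) \<cdot>\<^sub>v unit_vec d j"
    unfolding m by (simp add: smult_smult_assoc)
  then have "x m \<bullet> (mat_diag d (\<lambda>l. 1 / D l) *\<^sub>v x m) = a\<^sup>2 / \<omega>"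
    using j by (simp add: m power2_eq_square)
  moreover have "mat_diag d (\<lambda>l. 1 / D l) *\<^sub>v 0\<^sub>v d = 0\<^sub>v d"
    by (intro eq_vecI) (auto simp: mat_diag_def)
  ultimately show ?thesis
    unfolding ucb_score_def using j m response_vec_zero[of t S r d x, OF no_reward]
    by (simp add: inv real_sqrt_divide)
qed


section \<open>Optimal offers\<close>

lemma finite_feasible_offers: "finite {U. feasible_offer N K U}"
  by (rule finite_subset[of _ "Pow {1..N}"]) (auto simp: feasible_offer_def)

text \<open>If $K$ products all score higher than some product, one of them is absent from any
  $K$-element set containing that product, and exchanging the two improves the set.\<close>

lemma dominated_not_offered:
  fixes f :: "nat \<Rightarrow> real"
  assumes opt: "is_arg_max (\<lambda>U. \<Sum>i\<in>U. f i) (feasible_offer N K) U"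
    and B: "feasible_offer N K B" and less: "\<And>b. b \<in> B \<Longrightarrow> f m < f b"
  shows "m \<notin> U"
proof
  assume "m \<in> U"
  have "m \<notin> B" using less by blast
  have U: "U \<subseteq> {1..N}" "card U = K"
    using opt by (auto simp: is_arg_max_def feasible_offer_def)
  then have "finite U" by (auto intro: finite_subset)
  have "\<not> B \<subseteq> U"
    using card_subset_eq[OF \<open>finite U\<close>, of B] \<open>m \<in> U\<close> \<open>m \<notin> B\<close> U B
    by (auto simp: feasible_offer_def)
  then obtain b where b: "b \<in> B" "b \<notin> U" by blast
  have "card (insert b (U - {m})) = K"
    using b \<open>m \<in> U\<close> \<open>finite U\<close> U card_Suc_Diff1[of U m] by simp
  then have "feasible_offer N K (insert b (U - {m}))"
    using b U B by (auto simp: feasible_offer_def)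
  moreover have "(\<Sum>i\<in>insert b (U - {m}). f i) > (\<Sum>i\<in>U. f i)"
    using b \<open>m \<in> U\<close> \<open>finite U\<close> less[of b] by (simp add: sum_diff1)
  ultimately show False
    using opt by (auto simp: is_arg_max_def)
qed

lemma optimal_offer_ge:
  assumes "feasible_offer N K U"
  shows "(\<Sum>i\<in>U. mean_reward x \<theta> i) \<le> (\<Sum>i\<in>optimal_offer N K x \<theta>. mean_reward x \<theta> i)"
proof -
  let ?f = "\<lambda>U. \<Sum>i\<in>U. mean_reward x \<theta> i"
  have "finite (?f ` {U. feasible_offer N K U})" "?f ` {U. feasible_offer N K U} \<noteq> {}"
    using finite_feasible_offers assms by auto
  from Max_in[OF this] obtain M where M: "feasible_offer N K M"
    "?f M = Max (?f ` {U. feasible_offer N K U})" by auto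
  have "?f V \<le> ?f M" if "feasible_offer N K V" for V
    unfolding M(2) using that finite_feasible_offers by (intro Max_ge) auto
  then have "is_arg_max ?f (feasible_offer N K) M"
    using M by (simp add: is_arg_max_linorder)
  then have "is_arg_max ?f (feasible_offer N K) (optimal_offer N K x \<theta>)"
    unfolding optimal_offer_def arg_max_def by (rule someI)
  then show ?thesis
    using assms by (simp add: is_arg_max_linorder)
qed

text \<open>No period contributes negative regret, and a period in which only worthless products are
  offered contributes the value of the best offer, which is at least that of any given one.\<close>

lemma regret_ge_worthless_periods:
  assumes feasible: "\<And>t. t \<in> {1..T} \<Longrightarrow> feasible_offer N K (S t)"
    and worthless: "\<And>t i. t \<in> {1..T} \<Longrightarrow> t \<le> n \<Longrightarrow> i \<in> S t \<Longrightarrow> mean_reward x \<theta> i = 0"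
    and G: "feasible_offer N K G"
  shows "regret N K T x \<theta> S \<ge> real (min n T) * (\<Sum>i\<in>G. mean_reward x \<theta> i)"
proof -
  define opt where "opt = (\<Sum>i\<in>optimal_offer N K x \<theta>. mean_reward x \<theta> i)"
  define loss where "loss t = opt - (\<Sum>i\<in>S t. mean_reward x \<theta> i)" for t
  have "(\<Sum>i\<in>G. mean_reward x \<theta> i) \<le> loss t" if "t \<in> {1..min n T}" for t
  proof -
    have "(\<Sum>i\<in>S t. mean_reward x \<theta> i) = 0"
      using that worthless[of t] by (intro sum.neutral) auto
    then show ?thesis
      using optimal_offer_ge[OF G, of x \<theta>] by (simp add: loss_def opt_def)
  qed
  then have "(\<Sum>t=1..min n T. \<Sum>i\<in>G. mean_reward x \<theta> i) \<le> (\<Sum>t=1..min n T. loss t)"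
    by (rule sum_mono)
  also have "\<dots> \<le> (\<Sum>t=1..T. loss t)"
    using optimal_offer_ge[OF feasible] by (intro sum_mono2) (auto simp: loss_def opt_def)
  also have "\<dots> = regret N K T x \<theta> S"
    by (simp add: loss_def opt_def regret_def sum_subtractf)
  finally show ?thesis by simp
qed


section \<open>The law of the reward table\<close>

lemma finite_set_pmf_reward_table: "finite (set_pmf (reward_table N T x \<theta>))"
  unfolding reward_table_def by (subst set_Pi_pmf) auto

lemma reward_table_worthless:
  assumes "r \<in> set_pmf (reward_table N T x \<theta>)"
    and "s \<in> {1..T}" "i \<in> {1..N}" "mean_reward x \<theta> i = 0"
  shows "\<not> r (s, i)"
proof -
  have "r (s, i) \<in> set_pmf (bernoulli_pmf (mean_reward x \<theta> i))"
    using assms(1-3) unfolding reward_table_def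
    by (subst (asm) set_Pi_pmf) (auto simp: PiE_dflt_def)
  then show ?thesis
    using assms(4) by (auto simp: set_pmf_iff)
qed

lemma expectation_ge_of_support:
  fixes f :: "'a \<Rightarrow> real"
  assumes "finite (set_pmf p)" "\<And>r. r \<in> set_pmf p \<Longrightarrow> c \<le> f r"
  shows "c \<le> measure_pmf.expectation p f"
  using assms by (intro measure_pmf.integral_ge_const integrable_measure_pmf_finite)
    (auto simp: AE_measure_pmf_iff)


section \<open>The staircase instance\<close>

definition stair_axis :: "nat \<Rightarrow> nat \<Rightarrow> nat" where
  "stair_axis K i = (i - 1) div K"

text \<open>Any strictly decreasing function of the axis with values in $[1/2, 1]$ on the first $d$ axes
  would do: the strictness decides the order of exploration, and the bounds keep the instance
  admissible and the loss per period of order $K$.\<close>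

definition stair_length :: "nat \<Rightarrow> nat \<Rightarrow> real" where
  "stair_length d j = 1 - real j / (2 * real d)"

definition stair_feature :: "nat \<Rightarrow> nat \<Rightarrow> nat \<Rightarrow> real Matrix.vec" where
  "stair_feature d K i = stair_length d (stair_axis K i) \<cdot>\<^sub>v unit_vec d (stair_axis K i)"

abbreviation stair_param :: "nat \<Rightarrow> real Matrix.vec" where
  "stair_param d \<equiv> unit_vec d (d - 1)"

definition stair_block :: "nat \<Rightarrow> nat \<Rightarrow> nat set" where
  "stair_block K j = {j * K + 1..j * K + K}"

lemma stair_axis_less:
  assumes "i \<in> {1..d * K}"
  shows "stair_axis K i < d"
  using assms unfolding stair_axis_def by (intro less_mult_imp_div_less) auto

lemma stair_axis_block:
  assumes "i \<in> stair_block K j"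
  shows "stair_axis K i = j"
proof -
  have "i - 1 = (i - 1 - j * K) + j * K" "i - 1 - j * K < K"
    using assms by (auto simp: stair_block_def)
  then show ?thesis
    unfolding stair_axis_def
    by (metis add.commute add_0 div_less div_mult_self3 not_less0 mult.commute)
qed

lemma feasible_stair_block:
  assumes "j < d"
  shows "feasible_offer (d * K) K (stair_block K j)"
proof -
  have "Suc j * K \<le> d * K"
    using assms by (intro mult_le_mono1) simp
  then show ?thesis
    by (auto simp: feasible_offer_def stair_block_def)
qed

lemma stair_length_bounds:
  assumes "j < d"
  shows "1 / 2 \<le> stair_length d j" "stair_length d j \<le> 1"
  using assms by (auto simp: stair_length_def field_simps)

lemma stair_length_strict_antimono:
  assumes "j < l" "l < d"
  shows "stair_length d l < stair_length d j"
  using assms by (auto simp: stair_length_def field_simps)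

lemma stair_mean_reward:
  assumes "i \<in> {1..d * K}"
  shows "mean_reward (stair_feature d K) (stair_param d) i =
    (if stair_axis K i = d - 1 then stair_length d (d - 1) else 0)"
  using stair_axis_less[OF assms] by (auto simp: mean_reward_def stair_feature_def)

lemma stair_instance:
  assumes "d \<ge> 1"
  shows "semi_bandit_instance d (d * K) K (stair_feature d K) (stair_param d)"
proof -
  have "eucl_norm (stair_feature d K i) \<le> 1" if "i \<in> {1..d * K}" for i
    using stair_axis_less[OF that] stair_length_bounds[OF stair_axis_less[OF that]]
    by (simp add: eucl_norm_def stair_feature_def real_sqrt_mult_self)
  moreover have "mean_reward (stair_feature d K) (stair_param d) i \<in> {0..1}"
    if "i \<in> {1..d * K}" for i
    unfolding stair_mean_reward[OF that] using stair_length_bounds[of "d - 1" d] assms by auto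
  ultimately show ?thesis
    using assms by (auto simp: semi_bandit_instance_def stair_feature_def eucl_norm_def)
qed

text \<open>As long as the last axis is untouched, no reward has been seen. If the offers before
  period $t$ used only axes before number $t - 1$ (counting from $0$), then all later axes are
  unexplored, and the block of axis $t - 1$ has the $K$ highest scores on the axes from
  there on; so the products beyond it are dominated. From period $d$ on the claim is
  trivial.\<close>

lemma staircase_exploration:
  assumes "d \<ge> 2" "\<alpha> > 0" "\<omega> > 0"
    and run: "semi_ucb d (d * K) K T (stair_feature d K) \<alpha> \<omega> S"
    and r: "r \<in> set_pmf (reward_table (d * K) T (stair_feature d K) (stair_param d))"
    and "t \<in> {1..T}" "i \<in> S r t"
  shows "stair_axis K i < t"
  using \<open>t \<in> {1..T}\<close> \<open>i \<in> S r t\<close>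
proof (induction t arbitrary: i rule: less_induct)
  case (less t)
  let ?x = "stair_feature d K" and ?N = "d * K"
  let ?p = "ucb_score d ?x \<alpha> \<omega> r (S r) t"
  have opt: "is_arg_max (\<lambda>U. \<Sum>i\<in>U. ucb_score d ?x \<alpha> \<omega> r (S r) s i) (feasible_offer ?N K) (S r s)"
    if "s \<in> {1..T}" for s
    using run that by (auto simp: semi_ucb_def)
  then have offered: "S r s \<subseteq> {1..?N}" if "s \<in> {1..T}" for s
    using that by (auto simp: is_arg_max_def feasible_offer_def)
  show ?case
  proof (rule ccontr)
    assume beyond: "\<not> stair_axis K i < t"
    have i: "stair_axis K i < d"
      using offered[OF less.prems(1)] less.prems(2) by (intro stair_axis_less) blast
    have used: "k \<in> {1..?N}" "stair_axis K k < t - 1" if "s \<in> {1..t - 1}" "k \<in> S r s" for s k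
    proof -
      have s: "s < t" "s \<in> {1..T}" using that less.prems by auto
      show "k \<in> {1..?N}" using offered[OF s(2)] that by blast
      show "stair_axis K k < t - 1" using less.IH[OF s that(2)] that by simp
    qed
    have score: "?p m = \<alpha> * (stair_length d (stair_axis K m) / sqrt \<omega>)"
      if m: "stair_axis K m < d" "t - 1 \<le> stair_axis K m" for m
    proof -
      have "ucb_score d ?x \<alpha> \<omega> r (S r) (Suc (t - 1)) m =
          \<alpha> * (\<bar>stair_length d (stair_axis K m)\<bar> / sqrt \<omega>)"
      proof (rule ucb_score_unexplored[OF \<open>\<omega> > 0\<close> m(1)])
        show "?x k $ j * ?x k $ l = 0"
          if "s \<in> {1..t - 1}" "k \<in> S r s" "j < d" "l < d" "j \<noteq> l" for s k j l
          using that stair_axis_less[OF used(1)] by (auto simp: stair_feature_def)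
        show "?x k $ stair_axis K m = 0" if "s \<in> {1..t - 1}" "k \<in> S r s" for s k
          using used[OF that] m stair_axis_less[of k d K] by (auto simp: stair_feature_def)
        show "\<not> r (s, k)" if "s \<in> {1..t - 1}" "k \<in> S r s" for s k
        proof (rule reward_table_worthless[OF r])
          show "mean_reward ?x (stair_param d) k = 0"
            unfolding stair_mean_reward[OF used(1)[OF that]]
            using used(2)[OF that] beyond i by auto
        qed (use used[OF that] that less.prems in auto)
      qed (simp add: stair_feature_def)
      then show ?thesis
        using less.prems stair_length_bounds[OF m(1)] by simp
    qed
    have "?p i < ?p b" if "b \<in> stair_block K (t - 1)" for b
    proof -
      have b: "stair_axis K b = t - 1" using that by (rule stair_axis_block)
      have "stair_length d (stair_axis K i) < stair_length d (t - 1)"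
        using beyond i less.prems by (intro stair_length_strict_antimono) auto
      then show ?thesis
        using score[of i] score[of b] b beyond i less.prems \<open>\<alpha> > 0\<close> \<open>\<omega> > 0\<close>
        by (simp add: divide_strict_right_mono)
    qed
    moreover have "feasible_offer ?N K (stair_block K (t - 1))"
      using beyond i by (intro feasible_stair_block) simp
    ultimately have "i \<notin> S r t"
      using dominated_not_offered[OF opt[OF less.prems(1)]] by blast
    then show False using less.prems by blast
  qed
qed

text \<open>The optimal offer is the last block, worth at least $K/2$, and it is out of reach for
  $d - 1 \<ge> d/2$ periods.\<close>

lemma stair_regret:
  assumes "d \<ge> 2" "\<alpha> > 0" "\<omega> > 0"
    and run: "semi_ucb d (d * K) K T (stair_feature d K) \<alpha> \<omega> S"
    and r: "r \<in> set_pmf (reward_table (d * K) T (stair_feature d K) (stair_param d))"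
  shows "1 / 4 * (real K * real (min d T)) \<le> regret (d * K) K T (stair_feature d K) (stair_param d) (S r)"
proof -
  let ?\<mu> = "mean_reward (stair_feature d K) (stair_param d)" and ?G = "stair_block K (d - 1)"
  have feasible: "feasible_offer (d * K) K (S r t)" if "t \<in> {1..T}" for t
    using run that by (auto simp: semi_ucb_def is_arg_max_def)
  have G: "feasible_offer (d * K) K ?G"
    using assms by (intro feasible_stair_block) simp
  have worthless: "?\<mu> i = 0" if "t \<in> {1..T}" "t \<le> d - 1" "i \<in> S r t" for t i
    using staircase_exploration[OF assms that(1,3)] feasible[OF that(1)] that
    by (subst stair_mean_reward) (auto simp: feasible_offer_def)
  have "?\<mu> i = stair_length d (d - 1)" if "i \<in> ?G" for i
    using that G stair_axis_block[OF that]
    by (subst stair_mean_reward) (auto simp: feasible_offer_def)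
  then have "(\<Sum>i\<in>?G. ?\<mu> i) = real K * stair_length d (d - 1)"
    by (simp add: stair_block_def)
  moreover have "real K * (1 / 2) \<le> real K * stair_length d (d - 1)"
    using assms by (intro mult_left_mono stair_length_bounds(1)) auto
  ultimately have "real K * (1 / 2) \<le> (\<Sum>i\<in>?G. ?\<mu> i)"
    by simp
  moreover have "real (min d T) / 2 \<le> real (min (d - 1) T)"
    using assms by (auto simp: min_def)
  ultimately have "real (min d T) / 2 * (real K * (1 / 2)) \<le> real (min (d - 1) T) * (\<Sum>i\<in>?G. ?\<mu> i)"
    by (intro mult_mono) auto
  also have "\<dots> \<le> regret (d * K) K T (stair_feature d K) (stair_param d) (S r)"
    by (rule regret_ge_worthless_periods[OF feasible worthless G])
  finally show ?thesis by (simp add: mult.commute)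
qed

theorem theorem2:
  "\<exists>c::real. c > 0 \<and>
     (\<forall>(d::nat) (K::nat) (T::nat) (\<alpha>::real) (\<omega>::real).
        d \<ge> 2 \<and> K \<ge> 1 \<and> T \<ge> 1 \<and> \<alpha> > 0 \<and> \<omega> > 0 \<longrightarrow>
        (\<exists>(N::nat) (x :: nat \<Rightarrow> real Matrix.vec) (\<theta> :: real Matrix.vec).
           semi_bandit_instance d N K x \<theta> \<and>
           (\<forall>S. semi_ucb d N K T x \<alpha> \<omega> S \<longrightarrow>
              (AE r in measure_pmf (reward_table N T x \<theta>).
                 regret N K T x \<theta> (S r) \<ge> c * (real K * real (min d T))) \<and>
              measure_pmf.expectation (reward_table N T x \<theta>) (\<lambda>r. regret N K T x \<theta> (S r))
                \<ge> c * (real K * real (min d T)))))"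
proof (intro exI[of _ "1/4 :: real"] conjI allI impI)
  fix d K T :: nat and \<alpha> \<omega> :: real
  assume A: "d \<ge> 2 \<and> K \<ge> 1 \<and> T \<ge> 1 \<and> \<alpha> > 0 \<and> \<omega> > 0"
  let ?N = "d * K" and ?x = "stair_feature d K" and ?\<theta> = "stair_param d"
  have "(AE r in measure_pmf (reward_table ?N T ?x ?\<theta>).
          regret ?N K T ?x ?\<theta> (S r) \<ge> 1 / 4 * (real K * real (min d T))) \<and>
        measure_pmf.expectation (reward_table ?N T ?x ?\<theta>) (\<lambda>r. regret ?N K T ?x ?\<theta> (S r))
          \<ge> 1 / 4 * (real K * real (min d T))"
    if "semi_ucb d ?N K T ?x \<alpha> \<omega> S" for S
    unfolding AE_measure_pmf_iff
    using stair_regret[OF _ _ _ that] A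
    by (intro conjI ballI expectation_ge_of_support finite_set_pmf_reward_table) auto
  then show "\<exists>N x \<theta>. semi_bandit_instance d N K x \<theta> \<and>
           (\<forall>S. semi_ucb d N K T x \<alpha> \<omega> S \<longrightarrow>
              (AE r in measure_pmf (reward_table N T x \<theta>).
                 regret N K T x \<theta> (S r) \<ge> 1 / 4 * (real K * real (min d T))) \<and>
              measure_pmf.expectation (reward_table N T x \<theta>) (\<lambda>r. regret N K T x \<theta> (S r))
                \<ge> 1 / 4 * (real K * real (min d T)))"
    using stair_instance[of d K] A
    by (intro exI[of _ ?N] exI[of _ ?x] exI[of _ ?\<theta>]) auto
qed simp

end
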